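(* Let $p=(12,R)$ be the mesh pattern with $R=\{(0,0),(0,1),(1,0),(1,2),(2,1),(2,2)\}$. Let $F(x)=\sum_{n\ge0}n!\,x^n$, $F(x,q)=\sum_{n\ge 0}x^n\sum_{\pi\in S_n}q^{p(\pi)}$, and $A(x)=\sum_{n\ge0}|S_n(p)|x^n$. Then, as formal power series in $x$, $$A(x)=\frac{F(x)}{1+x^2F(x)^2},\qquad F(x,q)=\frac{F(x)}{1+x^2(1-q)F(x)^2}.$$
   Context: $S_n$ is the set of permutations $\pi=\pi_1\cdots\pi_n$ of $\{1,\dots,n\}$ ($S_0$ contains only the empty permutation). A mesh pattern $(12,R)$ consists of the permutation $12$ and a set $R\subseteq\{0,1,2\}\times\{0,1,2\}$ of shaded boxes. An occurrence of $(12,R)$ in $\pi\in S_n$ is a pair of positions $s<t$ with $\pi_s<\pi_t$ such that, putting $s_0=0,\ s_1=s,\ s_2=t,\ s_3=n+1$ and $v_0=0,\ v_1=\pi_s,\ v_2=\pi_t,\ v_3=n+1$, for every $(i,j)\in R$ there is no position $m$ with $s_i<m<s_{i+1}$ and $v_j<\pi_m<v_{j+1}$. $p(\pi)$ is the number of occurrences of $p$ in $\pi$, and $S_n(p)$ is the set of $\pi\in S_n$ with $p(\pi)=0$ (permutations avoiding $p$). *)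

theory Defs
  imports
    "HOL-Combinatorics.Permutations"
    "HOL-Computational_Algebra.Computational_Algebra"
begin

text \<open>
  A permutation \<open>\<pi>\<^sub>1\<dots>\<pi>\<^sub>n\<close> is the function \<open>i \<mapsto> \<pi>\<^sub>i\<close>, extended by the identity
  outside \<open>{1..n}\<close>; thus \<open>S\<^sub>0 = {id}\<close>.
\<close>

definition Sym :: "nat \<Rightarrow> (nat \<Rightarrow> nat) set" where
  "Sym n = {\<pi>. \<pi> permutes {1..n}}"

text \<open>
  Occurrences of the mesh pattern \<open>(12, R)\<close> in \<open>\<pi> \<in> S\<^sub>n\<close>, as pairs of positions. The lists
  are \<open>(s\<^sub>0,s\<^sub>1,s\<^sub>2,s\<^sub>3)\<close> and \<open>(v\<^sub>0,v\<^sub>1,v\<^sub>2,v\<^sub>3)\<close>; only \<open>R \<subseteq> {0,1,2} \<times> {0,1,2}\<close> is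
  meaningful.
\<close>

definition mesh12_occurrences ::
    "(nat \<times> nat) set \<Rightarrow> nat \<Rightarrow> (nat \<Rightarrow> nat) \<Rightarrow> (nat \<times> nat) set" where
  "mesh12_occurrences R n \<pi> =
     {(s, t). s \<in> {1..n} \<and> t \<in> {1..n} \<and> s < t \<and> \<pi> s < \<pi> t \<and>
        (\<forall>(i, j) \<in> R. \<not> (\<exists>m \<in> {1..n}.
            [0, s, t, n + 1] ! i < m \<and> m < [0, s, t, n + 1] ! (i + 1) \<and>
            [0, \<pi> s, \<pi> t, n + 1] ! j < \<pi> m \<and> \<pi> m < [0, \<pi> s, \<pi> t, n + 1] ! (j + 1)))}"

definition mesh12_count :: "(nat \<times> nat) set \<Rightarrow> nat \<Rightarrow> (nat \<Rightarrow> nat) \<Rightarrow> nat" where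
  "mesh12_count R n \<pi> = card (mesh12_occurrences R n \<pi>)"

definition mesh12_avoiders :: "(nat \<times> nat) set \<Rightarrow> nat \<Rightarrow> (nat \<Rightarrow> nat) set" where
  "mesh12_avoiders R n = {\<pi> \<in> Sym n. mesh12_count R n \<pi> = 0}"

definition fact_fps :: "'a::semiring_char_0 fps" where
  "fact_fps = Abs_fps (\<lambda>n. fact n)"

definition avoider_fps :: "(nat \<times> nat) set \<Rightarrow> rat fps" where
  "avoider_fps R = Abs_fps (\<lambda>n. of_nat (card (mesh12_avoiders R n)))"

text \<open>
  The distribution is a power series in \<open>x\<close> whose coefficients are polynomials in the
  indeterminate \<open>q\<close>. These are taken inside the field \<open>\<rat>(q)\<close>, since power series
  division needs an inverse operation on the coefficients.
\<close>

definition qvar :: "rat poly fract" where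
  "qvar = to_fract [:0, 1:]"

definition distribution_fps :: "(nat \<times> nat) set \<Rightarrow> rat poly fract fps" where
  "distribution_fps R = Abs_fps (\<lambda>n. \<Sum>\<pi>\<in>Sym n. qvar ^ mesh12_count R n \<pi>)"

end

theory Submission
  imports Defs
begin

text \<open>
  The unshaded boxes of \<open>p\<close> are the three on the antidiagonal, so an occurrence of \<open>p\<close> in \<open>\<pi>\<close>
  is the same thing as a skew decomposition \<open>\<pi> = \<sigma> \<ominus> (1 \<oplus> \<tau> \<oplus> 1) \<ominus> \<rho>\<close>, where \<open>\<sigma>\<close>, \<open>\<tau>\<close>, \<open>\<rho>\<close> are
  arbitrary permutations (lemma \<open>bij_betw_glue\<close>). The blocks \<open>1 \<oplus> \<tau> \<oplus> 1\<close> of one permutation are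
  disjoint intervals of positions, hence linearly ordered, and those that lie before the chosen
  one are exactly the blocks of \<open>\<sigma>\<close> (lemma \<open>framed_blocks_before\<close>). Thus, if each pair (permutation,
  block) gets the weight \<open>q\<close> to the number of earlier blocks, the generating function of such
  pairs is \<open>x\<^sup>2 F(x,q) F(x)\<^sup>2\<close>.

  On the other hand, the weights of the \<open>c = p(\<pi>)\<close> blocks of one \<open>\<pi>\<close> are \<open>1, q, \<dots>, q\<^bsup>c-1\<^esup>\<close>, and
  \<open>(q - 1)(1 + q + \<dots> + q\<^bsup>c-1\<^esup>) = q\<^bsup>c\<^esup> - 1\<close>. Summing over \<open>\<pi>\<close> gives
  \[ F(x,q) - F(x) = (q - 1) x^2 F(x,q) F(x)^2, \]
  which is linear in \<open>F(x,q)\<close> and yields the formula for it. The argument works for any value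
  of \<open>q\<close> in a field of characteristic 0; the value \<open>q = 0\<close> in \<open>\<rat>\<close> counts the avoiders.
\<close>

section \<open>Occurrences as framed blocks\<close>

text \<open>
  A pair \<open>(s, t)\<close> stands for a skew component \<open>1 \<oplus> \<tau> \<oplus> 1\<close> by the positions of its first and last
  entries. The condition names the unshaded boxes instead of the shaded ones, so that it compares
  one further entry at a time with these two and restricts well to parts of \<open>\<pi>\<close>.
\<close>

definition framed_blocks :: "nat \<Rightarrow> (nat \<Rightarrow> nat) \<Rightarrow> (nat \<times> nat) set" where
  "framed_blocks n \<pi> = {(s, t). 1 \<le> s \<and> s < t \<and> t \<le> n \<and> \<pi> s < \<pi> t \<and>
     (\<forall>m\<in>{1..n}. (m < s \<longrightarrow> \<pi> t < \<pi> m) \<and> (s < m \<and> m < t \<longrightarrow> \<pi> s < \<pi> m \<and> \<pi> m < \<pi> t) \<and>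
                (t < m \<longrightarrow> \<pi> m < \<pi> s))}"

lemma Sym_range: "\<pi> \<in> Sym n \<Longrightarrow> m \<in> {1..n} \<Longrightarrow> \<pi> m \<in> {1..n}"
  unfolding Sym_def by (simp only: mem_Collect_eq permutes_in_image)

lemma Sym_fixes: "\<pi> \<in> Sym n \<Longrightarrow> m \<notin> {1..n} \<Longrightarrow> \<pi> m = m"
  unfolding Sym_def by (auto simp: permutes_def)

lemma Sym_inj: "\<pi> \<in> Sym n \<Longrightarrow> inj \<pi>"
  unfolding Sym_def by (auto intro: permutes_inj)

lemma SymI:
  assumes "inj_on \<pi> {1..n}" "\<And>m. m \<in> {1..n} \<Longrightarrow> \<pi> m \<in> {1..n}" "\<And>m. m \<notin> {1..n} \<Longrightarrow> \<pi> m = m"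
  shows "\<pi> \<in> Sym n"
  unfolding Sym_def using assms
  by (auto intro!: bij_imp_permutes simp: bij_betw_def endo_inj_surj image_subset_iff)

lemma finite_Sym: "finite (Sym n)"
  unfolding Sym_def by (simp add: finite_permutations)

lemma card_Sym: "card (Sym n) = fact n"
  unfolding Sym_def by (simp add: card_permutations)

lemma finite_framed_blocks: "finite (framed_blocks n \<pi>)"
  by (rule finite_subset[of _ "{1..n} \<times> {1..n}"]) (auto simp: framed_blocks_def)

lemma mesh12_occurrences_eq_framed_blocks:
  assumes R: "R = {(0,0), (0,1), (1,0), (1,2), (2,1), (2,2)}" and \<pi>: "\<pi> \<in> Sym n"
  shows "mesh12_occurrences R n \<pi> = framed_blocks n \<pi>"
proof -
  have "(s, t) \<in> mesh12_occurrences R n \<pi> \<longleftrightarrow> (s, t) \<in> framed_blocks n \<pi>" for s t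
  proof (cases "1 \<le> s \<and> s < t \<and> t \<le> n \<and> \<pi> s < \<pi> t")
    case True
    \<comment> \<open>No entry other than those at \<open>s\<close> and \<open>t\<close> has the value \<open>\<pi> s\<close> or \<open>\<pi> t\<close>, so it lies in the
      interior of one of the nine boxes, and excluding two boxes of a column leaves the third.\<close>
    let ?box = "\<lambda>i j m. [0, s, t, n + 1] ! i < m \<and> m < [0, s, t, n + 1] ! (i + 1) \<and>
        [0, \<pi> s, \<pi> t, n + 1] ! j < \<pi> m \<and> \<pi> m < [0, \<pi> s, \<pi> t, n + 1] ! (j + 1)"
    let ?bands = "\<lambda>m. (m < s \<longrightarrow> \<pi> t < \<pi> m) \<and> (s < m \<and> m < t \<longrightarrow> \<pi> s < \<pi> m \<and> \<pi> m < \<pi> t) \<and>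
        (t < m \<longrightarrow> \<pi> m < \<pi> s)"
    have "(\<forall>(i, j) \<in> R. \<not> ?box i j m) \<longleftrightarrow> ?bands m" if m: "m \<in> {1..n}" for m
    proof -
      have "\<pi> m \<in> {1..n}" "m \<noteq> s \<longrightarrow> \<pi> m \<noteq> \<pi> s" "m \<noteq> t \<longrightarrow> \<pi> m \<noteq> \<pi> t"
        using Sym_range[OF \<pi> m] Sym_inj[OF \<pi>] by (auto dest: injD)
      then show ?thesis
        using True m unfolding R by (simp add: numeral_2_eq_2) linarith
    qed
    then have "(\<forall>m\<in>{1..n}. \<forall>(i, j) \<in> R. \<not> ?box i j m) \<longleftrightarrow> (\<forall>m\<in>{1..n}. ?bands m)"
      by (rule ball_cong[OF refl])
    moreover have "(\<forall>(i, j) \<in> R. \<not> (\<exists>m\<in>{1..n}. ?box i j m)) \<longleftrightarrow>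
        (\<forall>m\<in>{1..n}. \<forall>(i, j) \<in> R. \<not> ?box i j m)"
      by (rule iffI; clarify) blast+
    moreover have "s \<in> {1..n}" "t \<in> {1..n}" using True by auto
    ultimately show ?thesis
      using True unfolding mesh12_occurrences_def framed_blocks_def mem_Collect_eq prod.case
      by argo
  next
    case False
    then show ?thesis
      unfolding mesh12_occurrences_def framed_blocks_def by auto
  qed
  then show ?thesis by auto
qed

text \<open>
  Blocks with the same first position coincide, since the later of two last positions would
  hold a value both above and below the value at the first position.
\<close>

lemma inj_on_fst_framed_blocks: "inj_on fst (framed_blocks n \<pi>)"
proof -
  have False if "(s, t) \<in> framed_blocks n \<pi>" "(s, t') \<in> framed_blocks n \<pi>" "t < t'" for s t t'
  proof -
    have "t' \<in> {1..n}" "\<pi> s < \<pi> t'" using that(2) by (auto simp: framed_blocks_def)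
    moreover have "\<forall>m\<in>{1..n}. t < m \<longrightarrow> \<pi> m < \<pi> s" using that(1) by (auto simp: framed_blocks_def)
    ultimately show False using \<open>t < t'\<close> by (meson less_asym)
  qed
  then show ?thesis
    unfolding inj_on_def by (metis linorder_neqE_nat prod.collapse)
qed

text \<open>
  The entries below the value at \<open>i + 1\<close> are those right of the block, and the entries above
  the value at \<open>i + j + 2\<close> are those left of it; counting them determines both values.
\<close>

lemma framed_blocks_iff:
  assumes \<pi>: "\<pi> \<in> Sym n" and n: "n = i + j + k + 2"
  shows "(i + 1, i + j + 2) \<in> framed_blocks n \<pi> \<longleftrightarrow>
    \<pi> (i + 1) = k + 1 \<and> \<pi> (i + j + 2) = k + j + 2 \<and>
    (\<forall>m\<in>{1..i}. \<pi> (0 + m) \<in> {j + k + 2 + 1..j + k + 2 + i}) \<and>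
    (\<forall>m\<in>{1..j}. \<pi> (i + 1 + m) \<in> {k + 1 + 1..k + 1 + j}) \<and>
    (\<forall>m\<in>{1..k}. \<pi> (i + j + 2 + m) \<in> {0 + 1..0 + k})" (is "?L \<longleftrightarrow> ?R")
proof
  assume L: ?L
  let ?s = "i + 1" and ?t = "i + j + 2"
  have perm: "\<pi> ` {1..n} = {1..n}"
    using \<pi> by (simp add: Sym_def permutes_image)
  have inj: "inj_on \<pi> A" for A
    using Sym_inj[OF \<pi>] by (rule inj_on_subset) simp
  have st: "\<pi> ?s < \<pi> ?t"
    and left: "\<And>m. m \<in> {1..n} \<Longrightarrow> m < ?s \<Longrightarrow> \<pi> ?t < \<pi> m"
    and mid: "\<And>m. m \<in> {1..n} \<Longrightarrow> ?s < m \<Longrightarrow> m < ?t \<Longrightarrow> \<pi> ?s < \<pi> m \<and> \<pi> m < \<pi> ?t"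
    and right: "\<And>m. m \<in> {1..n} \<Longrightarrow> ?t < m \<Longrightarrow> \<pi> m < \<pi> ?s"
    using L unfolding framed_blocks_def by auto
  have split: "m < ?s \<or> m = ?s \<or> ?s < m \<and> m < ?t \<or> m = ?t \<or> ?t < m" for m by linarith
  have low: "{1..<\<pi> ?s} = \<pi> ` {?t + 1..n}"
  proof
    show "\<pi> ` {?t + 1..n} \<subseteq> {1..<\<pi> ?s}"
      using right Sym_range[OF \<pi>] by fastforce
    show "{1..<\<pi> ?s} \<subseteq> \<pi> ` {?t + 1..n}"
    proof
      fix v assume v: "v \<in> {1..<\<pi> ?s}"
      have "\<pi> ?s \<le> n" using Sym_range[OF \<pi>, of ?s] n by simp
      then have "v \<in> \<pi> ` {1..n}" using v perm by simp
      then obtain m where m: "m \<in> {1..n}" "v = \<pi> m" by blast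
      then have "?t < m" using v split[of m] left[of m] mid[of m] st by auto
      then show "v \<in> \<pi> ` {?t + 1..n}" using m by auto
    qed
  qed
  have high: "{\<pi> ?t<..n} = \<pi> ` {1..i}"
  proof
    show "\<pi> ` {1..i} \<subseteq> {\<pi> ?t<..n}"
      using left Sym_range[OF \<pi>] n by fastforce
    show "{\<pi> ?t<..n} \<subseteq> \<pi> ` {1..i}"
    proof
      fix v assume v: "v \<in> {\<pi> ?t<..n}"
      then have "v \<in> \<pi> ` {1..n}" using perm by simp
      then obtain m where m: "m \<in> {1..n}" "v = \<pi> m" by blast
      then have "m < ?s" using v split[of m] right[of m] mid[of m] st by auto
      then show "v \<in> \<pi> ` {1..i}" using m by auto
    qed
  qed
  have "\<pi> ?s - 1 = k"
    using arg_cong[OF low, of card] n by (simp add: card_image[OF inj])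
  moreover have "\<pi> ?s \<ge> 1" using Sym_range[OF \<pi>, of ?s] n by simp
  ultimately have s: "\<pi> ?s = k + 1" by simp
  have "n - \<pi> ?t = i"
    using arg_cong[OF high, of card] by (simp add: card_image[OF inj])
  moreover have "\<pi> ?t \<le> n" using Sym_range[OF \<pi>, of ?t] n by simp
  ultimately have t: "\<pi> ?t = k + j + 2" using n by simp
  have "\<pi> (0 + m) \<in> {j + k + 2 + 1..j + k + 2 + i}" if "m \<in> {1..i}" for m
    using left[of m] Sym_range[OF \<pi>, of m] that n t by auto
  moreover have "\<pi> (i + 1 + m) \<in> {k + 1 + 1..k + 1 + j}" if "m \<in> {1..j}" for m
    using mid[of "i + 1 + m"] that n s t by auto
  moreover have "\<pi> (i + j + 2 + m) \<in> {0 + 1..0 + k}" if "m \<in> {1..k}" for m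
    using right[of "i + j + 2 + m"] Sym_range[OF \<pi>, of "i + j + 2 + m"] that n s by auto
  ultimately show ?R using s t by blast
next
  assume R: ?R
  have "(m < i + 1 \<longrightarrow> \<pi> (i + j + 2) < \<pi> m) \<and>
     (i + 1 < m \<and> m < i + j + 2 \<longrightarrow> \<pi> (i + 1) < \<pi> m \<and> \<pi> m < \<pi> (i + j + 2)) \<and>
     (i + j + 2 < m \<longrightarrow> \<pi> m < \<pi> (i + 1))" if m: "m \<in> {1..n}" for m
  proof (intro conjI impI)
    assume "m < i + 1"
    then have "m \<in> {1..i}" using m by simp
    with R have "\<pi> (0 + m) \<in> {j + k + 2 + 1..j + k + 2 + i}" by blast
    with R show "\<pi> (i + j + 2) < \<pi> m" by simp
  next
    assume "i + 1 < m \<and> m < i + j + 2"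
    then have "m - (i + 1) \<in> {1..j}" "i + 1 + (m - (i + 1)) = m" by auto
    with R have *: "\<pi> m \<in> {k + 1 + 1..k + 1 + j}" by metis
    with R show "\<pi> (i + 1) < \<pi> m" by simp
    from R * show "\<pi> m < \<pi> (i + j + 2)" by simp
  next
    assume "i + j + 2 < m"
    then have "m - (i + j + 2) \<in> {1..k}" "i + j + 2 + (m - (i + j + 2)) = m" using m n by auto
    with R have "\<pi> m \<in> {0 + 1..0 + k}" by metis
    with R show "\<pi> m < \<pi> (i + 1)" by simp
  qed
  with R n show ?L unfolding framed_blocks_def by auto
qed

section \<open>Decomposing a permutation at a block\<close>

text \<open>The permutation \<open>\<sigma> \<ominus> (1 \<oplus> \<tau> \<oplus> 1) \<ominus> \<rho>\<close> for \<open>\<sigma>\<close>, \<open>\<tau>\<close>, \<open>\<rho>\<close> of lengths \<open>i\<close>, \<open>j\<close>, \<open>k\<close>.\<close>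

definition glue ::
    "nat \<Rightarrow> nat \<Rightarrow> nat \<Rightarrow> (nat \<Rightarrow> nat) \<times> (nat \<Rightarrow> nat) \<times> (nat \<Rightarrow> nat) \<Rightarrow> nat \<Rightarrow> nat" where
  "glue i j k = (\<lambda>(\<sigma>, \<tau>, \<rho>) m.
     if m \<in> {1..i} then j + k + 2 + \<sigma> m
     else if m = i + 1 then k + 1
     else if m \<in> {i + 2..i + j + 1} then k + 1 + \<tau> (m - (i + 1))
     else if m = i + j + 2 then k + j + 2
     else if m \<in> {i + j + 3..i + j + k + 2} then \<rho> (m - (i + j + 2))
     else m)"

text \<open>
  Recovers one of the three permutations from the glued one. It is meant for values of \<open>\<pi>\<close> above
  \<open>b\<close> at these positions; otherwise the subtraction truncates.
\<close>

definition window :: "nat \<Rightarrow> nat \<Rightarrow> nat \<Rightarrow> (nat \<Rightarrow> nat) \<Rightarrow> nat \<Rightarrow> nat" where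
  "window a b l \<pi> m = (if m \<in> {1..l} then \<pi> (a + m) - b else m)"

lemma window_in_Sym:
  assumes "inj \<pi>" and "\<forall>m\<in>{1..l}. \<pi> (a + m) \<in> {b + 1..b + l}"
  shows "window a b l \<pi> \<in> Sym l"
proof (rule SymI)
  show "inj_on (window a b l \<pi>) {1..l}"
  proof (rule inj_onI)
    fix x y assume xy: "x \<in> {1..l}" "y \<in> {1..l}" "window a b l \<pi> x = window a b l \<pi> y"
    with assms(2) have "\<pi> (a + x) \<in> {b + 1..b + l}" "\<pi> (a + y) \<in> {b + 1..b + l}" by blast+
    with xy have "\<pi> (a + x) = \<pi> (a + y)" by (simp add: window_def) linarith
    with injD[OF \<open>inj \<pi>\<close>] show "x = y" by fastforce
  qed
next
  fix m assume m: "m \<in> {1..l}"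
  with assms(2) have "\<pi> (a + m) \<in> {b + 1..b + l}" by blast
  with m show "window a b l \<pi> m \<in> {1..l}" by (auto simp: window_def)
qed (auto simp: window_def)

lemma glue_in_Sym:
  assumes "\<sigma> \<in> Sym i" "\<tau> \<in> Sym j" "\<rho> \<in> Sym k"
  shows "glue i j k (\<sigma>, \<tau>, \<rho>) \<in> Sym (i + j + k + 2)"
proof (rule SymI)
  have \<sigma>: "m \<in> {1..i} \<Longrightarrow> \<sigma> m \<in> {1..i}" and \<tau>: "m \<in> {1..j} \<Longrightarrow> \<tau> m \<in> {1..j}"
    and \<rho>: "m \<in> {1..k} \<Longrightarrow> \<rho> m \<in> {1..k}" for m
    using assms by (auto dest: Sym_range)
  have inj: "\<sigma> x = \<sigma> y \<longleftrightarrow> x = y" "\<tau> x = \<tau> y \<longleftrightarrow> x = y" "\<rho> x = \<rho> y \<longleftrightarrow> x = y" for x y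
    using assms[THEN Sym_inj] by (auto dest: injD)
  have mid: "m \<in> {i + 2..i + j + 1} \<Longrightarrow> m - (i + 1) \<in> {1..j}"
    and right: "m \<in> {i + j + 3..i + j + k + 2} \<Longrightarrow> m - (i + j + 2) \<in> {1..k}" for m
    by auto
  show "inj_on (glue i j k (\<sigma>, \<tau>, \<rho>)) {1..i + j + k + 2}"
  proof (rule linorder_inj_onI)
    fix x y assume "x < y" "x \<in> {1..i + j + k + 2}" "y \<in> {1..i + j + k + 2}"
    then show "glue i j k (\<sigma>, \<tau>, \<rho>) x \<noteq> glue i j k (\<sigma>, \<tau>, \<rho>) y"
      using \<sigma>[of x] \<sigma>[of y] \<tau>[OF mid, of x] \<tau>[OF mid, of y] \<rho>[OF right, of x] \<rho>[OF right, of y]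
      by (auto simp: glue_def inj split: if_splits)
  qed auto
  show "glue i j k (\<sigma>, \<tau>, \<rho>) m \<in> {1..i + j + k + 2}" if "m \<in> {1..i + j + k + 2}" for m
    using that \<sigma>[of m] \<tau>[OF mid, of m] \<rho>[OF right, of m] by (auto simp: glue_def)
qed (auto simp: glue_def)

lemma bij_betw_glue:
  "bij_betw (glue i j k) (Sym i \<times> Sym j \<times> Sym k)
     {\<pi> \<in> Sym (i + j + k + 2). (i + 1, i + j + 2) \<in> framed_blocks (i + j + k + 2) \<pi>}"
  (is "bij_betw _ ?A ?B")
proof -
  let ?split = "\<lambda>\<pi>. (window 0 (j + k + 2) i \<pi>, window (i + 1) (k + 1) j \<pi>, window (i + j + 2) 0 k \<pi>)"
  have split_glue: "\<forall>x\<in>?A. ?split (glue i j k x) = x"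
  proof
    fix x assume "x \<in> ?A"
    then obtain \<sigma> \<tau> \<rho> where x: "x = (\<sigma>, \<tau>, \<rho>)"
      and *: "\<sigma> \<in> Sym i" "\<tau> \<in> Sym j" "\<rho> \<in> Sym k" by auto
    have 1: "window 0 (j + k + 2) i (glue i j k (\<sigma>, \<tau>, \<rho>)) = \<sigma>"
      using Sym_fixes[OF *(1)] by (auto simp: window_def glue_def)
    have 2: "window (i + 1) (k + 1) j (glue i j k (\<sigma>, \<tau>, \<rho>)) = \<tau>"
      using Sym_fixes[OF *(2)] by (auto simp: window_def glue_def)
    have 3: "window (i + j + 2) 0 k (glue i j k (\<sigma>, \<tau>, \<rho>)) = \<rho>"
      using Sym_fixes[OF *(3)] by (auto simp: window_def glue_def)
    show "?split (glue i j k x) = x"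
      unfolding x 1 2 3 ..
  qed
  have parts: "\<pi> (i + 1) = k + 1 \<and> \<pi> (i + j + 2) = k + j + 2 \<and>
    (\<forall>m\<in>{1..i}. \<pi> (0 + m) \<in> {j + k + 2 + 1..j + k + 2 + i}) \<and>
    (\<forall>m\<in>{1..j}. \<pi> (i + 1 + m) \<in> {k + 1 + 1..k + 1 + j}) \<and>
    (\<forall>m\<in>{1..k}. \<pi> (i + j + 2 + m) \<in> {0 + 1..0 + k})" if "\<pi> \<in> ?B" for \<pi>
    using that framed_blocks_iff[of \<pi> "i + j + k + 2" i j k] by blast
  have glue_split: "\<forall>\<pi>\<in>?B. glue i j k (?split \<pi>) = \<pi>"
  proof (intro ballI ext)
    fix \<pi> m assume \<pi>: "\<pi> \<in> ?B"
    have left: "\<pi> x \<ge> j + k + 3" if "x \<in> {1..i}" for x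
    proof -
      have "\<pi> (0 + x) \<in> {j + k + 2 + 1..j + k + 2 + i}" using parts[OF \<pi>] that by blast
      then show ?thesis by simp
    qed
    have mid: "\<pi> (i + 1 + (x - (i + 1))) \<ge> k + 2" if "x \<in> {i + 2..i + j + 1}" for x
    proof -
      have "x - (i + 1) \<in> {1..j}" using that by auto
      then have "\<pi> (i + 1 + (x - (i + 1))) \<in> {k + 1 + 1..k + 1 + j}"
        using parts[OF \<pi>] by blast
      then show ?thesis by simp
    qed
    have fix_out: "\<pi> m = m" if "m \<notin> {1..i + j + k + 2}"
      using \<pi> that by (auto dest: Sym_fixes)
    consider "m \<in> {1..i}" | "m = i + 1" | "m \<in> {i + 2..i + j + 1}" | "m = i + j + 2"
      | "m \<in> {i + j + 3..i + j + k + 2}" | "m \<notin> {1..i + j + k + 2}"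
      unfolding atLeastAtMost_iff by linarith
    then show "glue i j k (?split \<pi>) m = \<pi> m"
    proof cases
      case 1 then show ?thesis using left[of m] by (simp add: glue_def window_def)
    next
      case 2 then show ?thesis using parts[OF \<pi>] by (simp add: glue_def)
    next
      case 3 then show ?thesis using mid[of m] by (auto simp: glue_def window_def)
    next
      case 4 then show ?thesis using parts[OF \<pi>] by (simp add: glue_def)
    next
      case 5
      then have "Suc (Suc (m - 2)) = m" by auto
      with 5 show ?thesis by (auto simp: glue_def window_def)
    next
      case 6 then show ?thesis using fix_out by (auto simp: glue_def)
    qed
  qed
  have glue_image: "glue i j k ` ?A \<subseteq> ?B"
  proof (rule image_subsetI)
    fix x assume "x \<in> ?A"
    then obtain \<sigma> \<tau> \<rho> where x: "x = (\<sigma>, \<tau>, \<rho>)"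
      and *: "\<sigma> \<in> Sym i" "\<tau> \<in> Sym j" "\<rho> \<in> Sym k" by auto
    let ?\<pi> = "glue i j k (\<sigma>, \<tau>, \<rho>)"
    have \<sigma>: "m \<in> {1..i} \<Longrightarrow> \<sigma> m \<in> {1..i}" and \<tau>: "m \<in> {1..j} \<Longrightarrow> \<tau> m \<in> {1..j}"
      and \<rho>: "m \<in> {1..k} \<Longrightarrow> \<rho> m \<in> {1..k}" for m
      using * by (auto dest: Sym_range)
    have "?\<pi> (0 + m) \<in> {j + k + 2 + 1..j + k + 2 + i}" if "m \<in> {1..i}" for m
      using that \<sigma>[of m] by (simp add: glue_def)
    moreover have "?\<pi> (i + 1 + m) \<in> {k + 1 + 1..k + 1 + j}" if "m \<in> {1..j}" for m
      using that \<tau>[of m] by (simp add: glue_def)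
    moreover have "?\<pi> (i + j + 2 + m) \<in> {0 + 1..0 + k}" if "m \<in> {1..k}" for m
      using that \<rho>[of m] by (simp add: glue_def)
    moreover have "?\<pi> (i + 1) = k + 1" "?\<pi> (i + j + 2) = k + j + 2"
      by (simp_all add: glue_def)
    ultimately have "(i + 1, i + j + 2) \<in> framed_blocks (i + j + k + 2) ?\<pi>"
      unfolding framed_blocks_iff[OF glue_in_Sym[OF *] refl] by blast
    then show "glue i j k x \<in> ?B"
      using glue_in_Sym[OF *] x by blast
  qed
  have split_image: "?split ` ?B \<subseteq> ?A"
  proof (rule image_subsetI)
    fix \<pi> assume \<pi>: "\<pi> \<in> ?B"
    then have "inj \<pi>" using Sym_inj by blast
    then show "?split \<pi> \<in> ?A"
      using parts[OF \<pi>] by (auto intro!: window_in_Sym simp del: One_nat_def)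
  qed
  show ?thesis
    by (rule bij_betw_byWitness[OF split_glue glue_split glue_image split_image])
qed

text \<open>
  In \<open>\<sigma> \<ominus> (1 \<oplus> \<tau> \<oplus> 1) \<ominus> \<rho>\<close>, the entries of the part \<open>\<sigma>\<close> exceed all entries after that part. Hence a block that
  starts in \<open>\<sigma>\<close> also ends there, and the entries after \<open>\<sigma>\<close> are no obstruction to its being a block.
\<close>

lemma framed_blocks_before:
  assumes *: "\<sigma> \<in> Sym i" "\<tau> \<in> Sym j" "\<rho> \<in> Sym k" and n: "n = i + j + k + 2"
  shows "{b \<in> framed_blocks n (glue i j k (\<sigma>, \<tau>, \<rho>)). fst b < i + 1} = framed_blocks i \<sigma>"
proof -
  let ?\<pi> = "glue i j k (\<sigma>, \<tau>, \<rho>)"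
  have \<tau>: "m \<in> {1..j} \<Longrightarrow> \<tau> m \<in> {1..j}"
    and \<rho>: "m \<in> {1..k} \<Longrightarrow> \<rho> m \<in> {1..k}" for m
    using * by (auto dest: Sym_range)
  have left: "?\<pi> m = j + k + 2 + \<sigma> m" if "m \<in> {1..i}" for m
    using that by (simp add: glue_def)
  have \<sigma>: "\<sigma> m \<ge> 1" if "m \<in> {1..i}" for m
    using Sym_range[OF *(1) that] by simp
  have right: "?\<pi> m < j + k + 3" if m: "m \<in> {i + 1..n}" for m
  proof -
    consider "m = i + 1 \<or> m = i + j + 2" | "i + 1 < m" "m < i + j + 2" | "i + j + 2 < m"
      using m by fastforce
    then show ?thesis
    proof cases
      case 1 then show ?thesis by (auto simp: glue_def)
    next
      case 2
      then have "m - (i + 1) \<in> {1..j}" by auto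
      with 2 \<tau>[OF this] show ?thesis by (auto simp: glue_def)
    next
      case 3
      then have "m - (i + j + 2) \<in> {1..k}" using m n by auto
      with 3 \<rho>[OF this] show ?thesis using m n by (auto simp: glue_def)
    qed
  qed
  have "(s, t) \<in> framed_blocks n ?\<pi> \<and> s < i + 1 \<longleftrightarrow> (s, t) \<in> framed_blocks i \<sigma>" for s t
  proof
    assume st: "(s, t) \<in> framed_blocks n ?\<pi> \<and> s < i + 1"
    then have b: "1 \<le> s" "s \<le> i" "s < t" "t \<le> n" "?\<pi> s < ?\<pi> t"
      unfolding framed_blocks_def by auto
    have t: "t \<le> i"
    proof (rule ccontr)
      assume "\<not> t \<le> i"
      with b right[of t] left[of s] \<sigma>[of s] show False by simp
    qed
    have eq: "?\<pi> s = j + k + 2 + \<sigma> s" "?\<pi> t = j + k + 2 + \<sigma> t"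
      using left b t by auto
    have "(m < s \<longrightarrow> \<sigma> t < \<sigma> m) \<and> (s < m \<and> m < t \<longrightarrow> \<sigma> s < \<sigma> m \<and> \<sigma> m < \<sigma> t) \<and>
                (t < m \<longrightarrow> \<sigma> m < \<sigma> s)" if "m \<in> {1..i}" for m
    proof -
      have "m \<in> {1..n}" using that n by simp
      then have "(m < s \<longrightarrow> ?\<pi> t < ?\<pi> m) \<and> (s < m \<and> m < t \<longrightarrow> ?\<pi> s < ?\<pi> m \<and> ?\<pi> m < ?\<pi> t) \<and>
                (t < m \<longrightarrow> ?\<pi> m < ?\<pi> s)"
        using st unfolding framed_blocks_def by blast
      then show ?thesis unfolding eq left[OF that] by simp
    qed
    with b t eq show "(s, t) \<in> framed_blocks i \<sigma>" unfolding framed_blocks_def by auto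
  next
    assume st: "(s, t) \<in> framed_blocks i \<sigma>"
    then have b: "1 \<le> s" "s < t" "t \<le> i" "\<sigma> s < \<sigma> t"
      unfolding framed_blocks_def by auto
    have eq: "?\<pi> s = j + k + 2 + \<sigma> s" "?\<pi> t = j + k + 2 + \<sigma> t"
      using left b by auto
    have "(m < s \<longrightarrow> ?\<pi> t < ?\<pi> m) \<and> (s < m \<and> m < t \<longrightarrow> ?\<pi> s < ?\<pi> m \<and> ?\<pi> m < ?\<pi> t) \<and>
                (t < m \<longrightarrow> ?\<pi> m < ?\<pi> s)" if m: "m \<in> {1..n}" for m
    proof (cases "m \<le> i")
      case True
      with m have m': "m \<in> {1..i}" by simp
      then show ?thesis using st unfolding eq left[OF m'] framed_blocks_def by auto
    next
      case False
      with b m right[of m] \<sigma>[of s] show ?thesis unfolding eq by auto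
    qed
    with b eq n show "(s, t) \<in> framed_blocks n ?\<pi> \<and> s < i + 1"
      unfolding framed_blocks_def by auto
  qed
  then show ?thesis
    unfolding set_eq_iff split_paired_All mem_Collect_eq fst_conv by blast
qed

section \<open>The weighted count of blocks\<close>

lemma sum_power_rank:
  fixes q :: "'a::comm_ring_1" and S :: "'b::linorder set"
  assumes "finite S"
  shows "(\<Sum>s\<in>S. q ^ card {s' \<in> S. s' < s}) = (\<Sum>l<card S. q ^ l)"
  using assms
proof (induction rule: finite_linorder_max_induct)
  case (insert b A)
  have "{s' \<in> insert b A. s' < b} = A" using insert by auto
  moreover have "{s' \<in> insert b A. s' < s} = {s' \<in> A. s' < s}" if "s \<in> A" for s
    using insert that by auto
  moreover have "b \<notin> A" using insert by auto
  ultimately show ?case using insert by (simp add: add.commute)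
qed simp

text \<open>
  The series \<open>F(x,q)\<close> with \<open>q\<close> an arbitrary ring element, so that one identity serves both the
  indeterminate and the value \<open>0\<close>.
\<close>

definition weighted_fps :: "'a::comm_ring_1 \<Rightarrow> 'a fps" where
  "weighted_fps q = Abs_fps (\<lambda>n. \<Sum>\<pi>\<in>Sym n. q ^ card (framed_blocks n \<pi>))"

text \<open>
  This is the telescoping identity \<open>(q - 1)(1 + \<dots> + q\<^bsup>c-1\<^esup>) = q\<^bsup>c\<^esup> - 1\<close>: the number
  of blocks to the left of a block runs through \<open>0, \<dots>, c - 1\<close>.
\<close>

lemma power_card_framed_blocks:
  fixes q :: "'a::comm_ring_1"
  shows "q ^ card (framed_blocks n \<pi>) - 1 =
    (q - 1) * (\<Sum>b\<in>framed_blocks n \<pi>. q ^ card {b' \<in> framed_blocks n \<pi>. fst b' < fst b})"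
proof -
  let ?B = "framed_blocks n \<pi>"
  have "card {b' \<in> ?B. fst b' < fst b} = card {s \<in> fst ` ?B. s < fst b}" for b :: "nat \<times> nat"
  proof -
    have "{s \<in> fst ` ?B. s < fst b} = fst ` {b' \<in> ?B. fst b' < fst b}" by auto
    then show ?thesis
      by (metis (no_types, lifting) card_image inj_on_fst_framed_blocks inj_on_subset
          mem_Collect_eq subsetI)
  qed
  then have "(\<Sum>b\<in>?B. q ^ card {b' \<in> ?B. fst b' < fst b}) =
      (\<Sum>s\<in>fst ` ?B. q ^ card {s' \<in> fst ` ?B. s' < s})"
    by (simp add: sum.reindex[OF inj_on_fst_framed_blocks])
  also have "\<dots> = (\<Sum>l<card ?B. q ^ l)"
    by (simp add: sum_power_rank finite_framed_blocks card_image[OF inj_on_fst_framed_blocks])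
  finally show ?thesis by (simp add: power_diff_1_eq)
qed

text \<open>
  The weight depends only on the part \<open>\<sigma>\<close> in front of the block; the parts inside and after it
  are free and contribute factorials.
\<close>

lemma sum_over_fixed_block:
  fixes q :: "'a::{comm_ring_1, semiring_char_0}"
  assumes n: "n = i + j + k + 2"
  shows "(\<Sum>\<pi> | \<pi> \<in> Sym n \<and> (i + 1, i + j + 2) \<in> framed_blocks n \<pi>.
            q ^ card {b \<in> framed_blocks n \<pi>. fst b < i + 1}) =
         (\<Sum>\<sigma>\<in>Sym i. q ^ card (framed_blocks i \<sigma>)) * (fact j * fact k)"
proof -
  have "(\<Sum>\<pi> | \<pi> \<in> Sym n \<and> (i + 1, i + j + 2) \<in> framed_blocks n \<pi>.
            q ^ card {b \<in> framed_blocks n \<pi>. fst b < i + 1}) =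
     (\<Sum>x\<in>Sym i \<times> Sym j \<times> Sym k. q ^ card {b \<in> framed_blocks n (glue i j k x). fst b < i + 1})"
    using sum.reindex_bij_betw[OF bij_betw_glue,
        of "\<lambda>\<pi>. q ^ card {b \<in> framed_blocks n \<pi>. fst b < i + 1}" i j k] n by simp
  also have "\<dots> = (\<Sum>(\<sigma>, y)\<in>Sym i \<times> Sym j \<times> Sym k. q ^ card (framed_blocks i \<sigma>))"
    using framed_blocks_before[OF _ _ _ n] by (intro sum.cong) auto
  also have "\<dots> = (\<Sum>\<sigma>\<in>Sym i. q ^ card (framed_blocks i \<sigma>)) * (fact j * fact k)"
    by (simp add: sum.cartesian_product[symmetric] card_cartesian_product card_Sym
        sum_distrib_left[symmetric] mult.commute)
  finally show ?thesis .
qed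

text \<open>
  Both sides sum the weights of all pairs (permutation of length \<open>N + 2\<close>, block); the right-hand
  side groups them by the numbers \<open>i\<close> and \<open>j\<close> of entries before and inside the block, and is
  the coefficient of \<open>x\<^bsup>N\<^esup>\<close> in \<open>F(x,q) F(x)\<^sup>2\<close>.
\<close>

lemma sum_over_framed_blocks:
  fixes q :: "'a::{comm_ring_1, semiring_char_0}"
  shows "(\<Sum>\<pi>\<in>Sym (N + 2). \<Sum>b\<in>framed_blocks (N + 2) \<pi>.
            q ^ card {b' \<in> framed_blocks (N + 2) \<pi>. fst b' < fst b}) =
    (\<Sum>i=0..N. (\<Sum>\<sigma>\<in>Sym i. q ^ card (framed_blocks i \<sigma>)) * (\<Sum>j=0..N-i. fact j * fact (N - i - j)))"
proof -
  let ?n = "N + 2"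
  let ?w = "\<lambda>\<pi> b. q ^ card {b' \<in> framed_blocks ?n \<pi>. fst b' < fst b}"
  let ?P = "{(s, t). 1 \<le> s \<and> s < t \<and> t \<le> ?n}"
  have fin: "finite ?P"
    by (rule finite_subset[of _ "{..?n} \<times> {..?n}"]) auto
  have "(\<Sum>\<pi>\<in>Sym ?n. \<Sum>b\<in>framed_blocks ?n \<pi>. ?w \<pi> b) =
        (\<Sum>\<pi>\<in>Sym ?n. \<Sum>b | b \<in> ?P \<and> b \<in> framed_blocks ?n \<pi>. ?w \<pi> b)"
    by (intro sum.cong refl) (auto simp: framed_blocks_def)
  also have "\<dots> = (\<Sum>b\<in>?P. \<Sum>\<pi> | \<pi> \<in> Sym ?n \<and> b \<in> framed_blocks ?n \<pi>. ?w \<pi> b)"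
    by (rule sum.swap_restrict[OF finite_Sym fin])
  also have "\<dots> = (\<Sum>(i, j)\<in>(SIGMA i:{0..N}. {0..N - i}).
      \<Sum>\<pi> | \<pi> \<in> Sym ?n \<and> (i + 1, i + j + 2) \<in> framed_blocks ?n \<pi>. ?w \<pi> (i + 1, i + j + 2))"
    by (rule sum.reindex_bij_witness[where i = "\<lambda>(i, j). (i + 1, i + j + 2)"
          and j = "\<lambda>(s, t). (s - 1, t - s - 1)"])
       (auto simp: Suc_diff_Suc numeral_2_eq_2)
  also have "\<dots> = (\<Sum>(i, j)\<in>(SIGMA i:{0..N}. {0..N - i}).
      (\<Sum>\<sigma>\<in>Sym i. q ^ card (framed_blocks i \<sigma>)) * (fact j * fact (N - i - j)))"
  proof (intro sum.cong refl, clarify)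
    fix i j assume "i \<in> {0..N}" "j \<in> {0..N - i}"
    then have "?n = i + j + (N - i - j) + 2" by auto
    from sum_over_fixed_block[OF this, of q]
    show "(\<Sum>\<pi> | \<pi> \<in> Sym ?n \<and> (i + 1, i + j + 2) \<in> framed_blocks ?n \<pi>. ?w \<pi> (i + 1, i + j + 2)) =
      (\<Sum>\<sigma>\<in>Sym i. q ^ card (framed_blocks i \<sigma>)) * (fact j * fact (N - i - j))"
      by simp
  qed
  also have "\<dots> = (\<Sum>i=0..N. \<Sum>j=0..N-i.
      (\<Sum>\<sigma>\<in>Sym i. q ^ card (framed_blocks i \<sigma>)) * (fact j * fact (N - i - j)))"
    by (rule sum.Sigma[symmetric]) auto
  finally show ?thesis by (simp add: sum_distrib_left)
qed

section \<open>The generating functions\<close>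

unbundle fps_syntax

lemma weighted_fps_minus_fact_fps:
  fixes q :: "'a::{comm_ring_1, semiring_char_0}"
  shows "weighted_fps q - fact_fps =
    fps_const (q - 1) * (fps_X ^ 2 * (weighted_fps q * (fact_fps * fact_fps)))"
proof (rule fps_ext)
  fix n
  have "(weighted_fps q - fact_fps) $ n = (\<Sum>\<pi>\<in>Sym n. q ^ card (framed_blocks n \<pi>) - 1)"
    by (simp add: weighted_fps_def fact_fps_def sum_subtractf card_Sym)
  also have "\<dots> = (q - 1) * (\<Sum>\<pi>\<in>Sym n. \<Sum>b\<in>framed_blocks n \<pi>.
            q ^ card {b' \<in> framed_blocks n \<pi>. fst b' < fst b})"
    by (simp add: power_card_framed_blocks sum_distrib_left)
  also have "(\<Sum>\<pi>\<in>Sym n. \<Sum>b\<in>framed_blocks n \<pi>.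
            q ^ card {b' \<in> framed_blocks n \<pi>. fst b' < fst b}) =
      (fps_X ^ 2 * (weighted_fps q * (fact_fps * fact_fps))) $ n"
  proof (cases "n < 2")
    case True
    then have "framed_blocks n \<pi> = {}" for \<pi> by (auto simp: framed_blocks_def)
    with True show ?thesis by (simp add: fps_X_power_mult_nth)
  next
    case False
    then obtain N where n: "n = N + 2" by (metis add.commute le_Suc_ex not_less)
    have shift: "(fps_X ^ 2 * f) $ n = f $ N" for f :: "'a fps"
      by (simp only: fps_X_power_mult_nth n) simp
    show ?thesis
      unfolding shift using sum_over_framed_blocks[of q N]
      by (simp only: n fps_mult_nth weighted_fps_def fact_fps_def fps_nth_Abs_fps)
  qed
  finally show "(weighted_fps q - fact_fps) $ n =
      (fps_const (q - 1) * (fps_X ^ 2 * (weighted_fps q * (fact_fps * fact_fps)))) $ n"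
    by simp
qed

lemma weighted_fps_eq:
  fixes q :: "'a::field_char_0"
  shows "weighted_fps q = fact_fps / (1 + fps_X ^ 2 * fps_const (1 - q) * fact_fps ^ 2)"
proof -
  let ?D = "1 + fps_X ^ 2 * fps_const (1 - q) * fact_fps ^ 2"
  have const: "fps_const (1 - q) = - fps_const (q - 1)"
    by (metis fps_const_neg minus_diff_eq)
  have "w * (1 + x * - c * f ^ 2) = w - c * (x * (w * (f * f)))" for w x c f :: "'a fps"
    by (simp add: algebra_simps power2_eq_square)
  then have "weighted_fps q * ?D =
      weighted_fps q - fps_const (q - 1) * (fps_X ^ 2 * (weighted_fps q * (fact_fps * fact_fps)))"
    unfolding const .
  also have "\<dots> = fact_fps"
    by (simp only: weighted_fps_minus_fact_fps[symmetric]) simp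
  finally have "weighted_fps q * ?D = fact_fps" .
  moreover have "?D $ 0 = 1" by (simp add: fps_mult_nth)
  then have "?D \<noteq> 0" by force
  ultimately show ?thesis by (metis nonzero_mult_div_cancel_right)
qed

theorem theorem3p4:
  fixes R :: "(nat \<times> nat) set"
  assumes "R = {(0,0), (0,1), (1,0), (1,2), (2,1), (2,2)}"
  shows "avoider_fps R = fact_fps / (1 + fps_X ^ 2 * fact_fps ^ 2) \<and>
         distribution_fps R = fact_fps / (1 + fps_X ^ 2 * fps_const (1 - qvar) * fact_fps ^ 2)"
proof
  have count: "mesh12_count R n \<pi> = card (framed_blocks n \<pi>)" if "\<pi> \<in> Sym n" for n \<pi>
    unfolding mesh12_count_def using mesh12_occurrences_eq_framed_blocks[OF assms that] by simp
  \<comment> \<open>Since \<open>0 ^ 0 = 1\<close>, the weight at \<open>q = 0\<close> is the indicator of avoidance.\<close>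
  have "of_nat (card (mesh12_avoiders R n)) =
      (\<Sum>\<pi>\<in>Sym n. (0::rat) ^ card (framed_blocks n \<pi>))" for n
  proof -
    have "(\<Sum>\<pi>\<in>Sym n. (0::rat) ^ card (framed_blocks n \<pi>)) =
        (\<Sum>\<pi>\<in>Sym n. if mesh12_count R n \<pi> = 0 then 1 else 0)"
      by (intro sum.cong) (auto simp: count power_0_left)
    also have "\<dots> = of_nat (card (mesh12_avoiders R n))"
      by (simp add: mesh12_avoiders_def sum.If_cases finite_Sym Int_def)
    finally show ?thesis by simp
  qed
  then have "avoider_fps R = weighted_fps 0"
    by (simp add: avoider_fps_def weighted_fps_def)
  then show "avoider_fps R = fact_fps / (1 + fps_X ^ 2 * fact_fps ^ 2)"
    by (simp add: weighted_fps_eq)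
  have "distribution_fps R = weighted_fps qvar"
    by (simp add: distribution_fps_def weighted_fps_def count)
  then show "distribution_fps R =
      fact_fps / (1 + fps_X ^ 2 * fps_const (1 - qvar) * fact_fps ^ 2)"
    by (simp add: weighted_fps_eq)
qed

end
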